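(* Let $G$ be a locally bipartite graph which contains $H_0$ as a subgraph. If $\delta(G) > \frac{8}{15}|G|$, then $G$ contains $H_2$ as a subgraph.
   Context: Graphs are finite and simple; $|G|$ is the number of vertices, $\delta(G)$ the minimum degree. A graph is locally bipartite if the neighbourhood of every vertex induces a bipartite graph. $H_0$ has vertices $a_0,\dots,a_6$ and edges $a_ia_{i+1}$ ($i$ mod 7) together with $a_0a_2$, $a_0a_5$, $a_1a_3$, $a_4a_6$. $H_2$ has vertices $a_0,\dots,a_6$ and edges $a_ia_{i+1}$ ($i$ mod 7) together with $a_1a_3$, $a_3a_5$, $a_5a_0$, $a_0a_2$, $a_2a_4$, $a_4a_6$ (i.e. the square of the 7-cycle minus the edge $a_6a_1$). *)

theory Defs
  imports Complex_Main
begin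

record 'a graph =
  verts :: "'a set"
  edges :: "'a set set"

definition simple_graph :: "'a graph \<Rightarrow> bool" where
  "simple_graph G \<longleftrightarrow>
     finite (verts G) \<and> (\<forall>e\<in>edges G. e \<subseteq> verts G \<and> card e = 2)"

definition neighbourhood :: "'a graph \<Rightarrow> 'a \<Rightarrow> 'a set" where
  "neighbourhood G v = {u \<in> verts G. {u, v} \<in> edges G}"

definition degree :: "'a graph \<Rightarrow> 'a \<Rightarrow> nat" where
  "degree G v = card (neighbourhood G v)"

text \<open>Meaningful for finite graphs with at least one vertex only.\<close>
definition min_degree :: "'a graph \<Rightarrow> nat" where
  "min_degree G = Min (degree G ` verts G)"

definition induced_subgraph :: "'a graph \<Rightarrow> 'a set \<Rightarrow> 'a graph" where
  "induced_subgraph G S = \<lparr>verts = S, edges = {e \<in> edges G. e \<subseteq> S}\<rparr>"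

text \<open>The two classes may be empty.\<close>
definition bipartite :: "'a graph \<Rightarrow> bool" where
  "bipartite G \<longleftrightarrow>
     (\<exists>A B. A \<union> B = verts G \<and> A \<inter> B = {} \<and>
        (\<forall>e\<in>edges G. \<not> e \<subseteq> A \<and> \<not> e \<subseteq> B))"

definition locally_bipartite :: "'a graph \<Rightarrow> bool" where
  "locally_bipartite G \<longleftrightarrow>
     (\<forall>v\<in>verts G. bipartite (induced_subgraph G (neighbourhood G v)))"

definition subgraph :: "'a graph \<Rightarrow> 'a graph \<Rightarrow> bool" where
  "subgraph H G \<longleftrightarrow> verts H \<subseteq> verts G \<and> edges H \<subseteq> edges G"

definition image_graph :: "('a \<Rightarrow> 'b) \<Rightarrow> 'a graph \<Rightarrow> 'b graph" where
  "image_graph f H = \<lparr>verts = f ` verts H, edges = (\<lambda>e. f ` e) ` edges H\<rparr>"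

text \<open>Some subgraph of \<open>G\<close>, not necessarily induced, is an isomorphic copy of \<open>H\<close>.\<close>
definition contains_subgraph :: "'a graph \<Rightarrow> 'b graph \<Rightarrow> bool" where
  "contains_subgraph G H \<longleftrightarrow>
     (\<exists>f. inj_on f (verts H) \<and> subgraph (image_graph f H) G)"

text \<open>The vertex \<open>a\<^sub>i\<close> is represented by the number \<open>i\<close>.\<close>
definition H0 :: "nat graph" where
  "H0 = \<lparr>verts = {0..<7},
         edges = {{i, (i + 1) mod 7} | i. i < 7} \<union> {{0, 2}, {0, 5}, {1, 3}, {4, 6}}\<rparr>"

definition H2 :: "nat graph" where
  "H2 = \<lparr>verts = {0..<7},
         edges = {{i, (i + 1) mod 7} | i. i < 7} \<union>
                 {{1, 3}, {3, 5}, {5, 0}, {0, 2}, {2, 4}, {4, 6}}\<rparr>"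

end

theory Submission imports Defs begin

text \<open>
  For every weighting of finitely many vertices of \<open>G\<close>, double counting yields a vertex whose
  neighbours carry more than \<open>8/15\<close> of the total weight. A homomorphism from \<open>H\<^sub>2\<close> into a locally
  bipartite graph is automatically injective, since identifying two vertices creates a \<open>K\<^sub>4\<close> or a
  5-wheel; hence vertices produced in this way never have to be shown distinct from earlier ones.
  Suppose there is no \<open>H\<^sub>2\<close>. Suitable weights of total 15 exclude a 7-vertex graph (\<open>F\<^sub>1\<close>, in
  \<open>no_F1\<close>); equal weights on a 4-cycle then exclude a second one (\<open>F\<^sub>2\<close>, in \<open>no_F2\<close>), and weights
  of total 15 on \<open>H\<^sub>0\<close> always produce a vertex completing a copy of \<open>K\<^sub>4\<close>, \<open>F\<^sub>1\<close> or \<open>F\<^sub>2\<close>.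
\<close>

text \<open>Bipartiteness of a neighbourhood is phrased as a colouring \<open>side\<close>, which
  makes excluding odd cycles there plain first-order reasoning. The degree bound is cleared of
  denominators to stay in the naturals.\<close>

locale dense_locally_bipartite =
  fixes V :: "'a set" and adj :: "'a \<Rightarrow> 'a \<Rightarrow> bool"
  assumes finite_V: "finite V"
    and adj_in_V: "adj u v \<Longrightarrow> u \<in> V"
    and adj_sym: "adj u v \<Longrightarrow> adj v u"
    and adj_irrefl: "\<not> adj v v"
    and local_colouring:
      "c \<in> V \<Longrightarrow> \<exists>side :: 'a \<Rightarrow> bool. \<forall>u v. adj c u \<longrightarrow> adj c v \<longrightarrow> adj u v \<longrightarrow> side u \<noteq> side v"
    and dense: "v \<in> V \<Longrightarrow> 8 * card V < 15 * card {u \<in> V. adj u v}"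
begin

lemma no_K4:
  assumes "adj a b" "adj a c" "adj a d" "adj b c" "adj b d" "adj c d"
  shows False
  using local_colouring[OF adj_in_V[OF assms(1)]] assms by metis

text \<open>The rim is a closed walk of odd length around \<open>c\<close>, which no 2-colouring
  admits, even if rim vertices coincide.\<close>

lemma no_W5:
  assumes "adj c a" "adj c b" "adj c d" "adj c e" "adj c f"
    and "adj a b" "adj b d" "adj d e" "adj e f" "adj f a"
  shows False
  using local_colouring[OF adj_in_V[OF assms(1)]] assms by metis

text \<open>Weights sit on list entries rather than vertices: entries with equal vertices just add
  up, so a configuration can be weighted before its vertices are known to be distinct.\<close>

lemma heavy_vertex:
  fixes ps :: "(nat \<times> 'a) list"
  assumes inV: "snd ` set ps \<subseteq> V"
    and pos: "0 < (\<Sum>(k, x)\<leftarrow>ps. k)"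
  shows "\<exists>v. 8 * (\<Sum>(k, x)\<leftarrow>ps. k) < 15 * (\<Sum>(k, x)\<leftarrow>ps. if adj v x then k else 0)"
proof (rule ccontr)
  let ?W = "\<lambda>v. \<Sum>(k, x)\<leftarrow>ps. if adj v x then k else 0"
  assume "\<not> ?thesis"
  then have le: "15 * ?W v \<le> 8 * (\<Sum>(k, x)\<leftarrow>ps. k)" for v
    by (simp add: not_less)
  have "(\<Sum>v\<in>V. ?W v) = (\<Sum>(k, x)\<leftarrow>ps. k * card {u \<in> V. adj u x})"
    using finite_V
    by (induction ps) (auto simp: sum.distrib sum.If_cases Int_def simp del: sum_eq_0_iff)
  \<comment> \<open>The \<open>+ 1\<close> stores the strictness of \<open>dense\<close> in a form
    that survives entries of weight 0; \<open>pos\<close> recovers a strict inequality at the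
    end.\<close>
  moreover have "(8 * card V + 1) * (\<Sum>(k, x)\<leftarrow>ps. k) \<le> 15 * (\<Sum>(k, x)\<leftarrow>ps. k * card {u \<in> V. adj u x})"
    using inV
  proof (induction ps)
    case Nil
    then show ?case by simp
  next
    case (Cons p ps)
    obtain k x where p: "p = (k, x)" by (cases p)
    have "k * (8 * card V + 1) \<le> k * (15 * card {u \<in> V. adj u x})"
      using Cons.prems dense[of x] p by (intro mult_le_mono2) auto
    moreover have "(8 * card V + 1) * (\<Sum>(k, x)\<leftarrow>ps. k) \<le> 15 * (\<Sum>(k, x)\<leftarrow>ps. k * card {u \<in> V. adj u x})"
      using Cons by simp
    ultimately have "k * (8 * card V + 1) + (8 * card V + 1) * (\<Sum>(k, x)\<leftarrow>ps. k)
        \<le> k * (15 * card {u \<in> V. adj u x}) + 15 * (\<Sum>(k, x)\<leftarrow>ps. k * card {u \<in> V. adj u x})"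
      by (rule add_mono)
    then show ?case by (simp add: p algebra_simps)
  qed
  moreover have "15 * (\<Sum>v\<in>V. ?W v) \<le> 8 * card V * (\<Sum>(k, x)\<leftarrow>ps. k)"
    using sum_mono[of V "\<lambda>v. 15 * ?W v" "\<lambda>_. 8 * (\<Sum>(k, x)\<leftarrow>ps. k)"] le
    by (simp add: sum_distrib_left mult_ac)
  ultimately show False using pos by (simp add: add_mult_distrib)
qed

text \<open>Eight pairs of vertices are non-adjacent in \<open>H2\<close>. Identifying
  \<open>a2\<close> with \<open>a5\<close> closes a 5-wheel around \<open>a2\<close>; each of the
  other seven identifications creates a \<open>K4\<close>.\<close>

lemma H2_hom_distinct:
  assumes "adj a0 a1" "adj a1 a2" "adj a2 a3" "adj a3 a4" "adj a4 a5" "adj a5 a6" "adj a6 a0"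
    and "adj a1 a3" "adj a3 a5" "adj a5 a0" "adj a0 a2" "adj a2 a4" "adj a4 a6"
  shows "distinct [a0, a1, a2, a3, a4, a5, a6]"
proof -
  note e = assms assms[THEN adj_sym]
  have "a0 \<noteq> a3" using no_K4[of a0 a4 a5 a6] e by blast
  moreover have "a0 \<noteq> a4" using no_K4[of a0 a1 a2 a3] e by blast
  moreover have "a1 \<noteq> a4" using no_K4[of a0 a1 a5 a6] e by blast
  moreover have "a1 \<noteq> a5" using no_K4[of a1 a2 a3 a4] e by blast
  moreover have "a2 \<noteq> a5" using no_W5[of a2 a0 a1 a3 a4 a6] e by blast
  moreover have "a1 \<noteq> a6" using no_K4[of a1 a2 a3 a4] e by blast
  moreover have "a2 \<noteq> a6" using no_K4[of a2 a3 a4 a5] e by blast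
  moreover have "a3 \<noteq> a6" using no_K4[of a0 a1 a2 a3] e by blast
  moreover have "a \<noteq> b" if "adj a b" for a b
    using that adj_irrefl by blast
  ultimately show ?thesis using e by simp
qed

end

text \<open>Homomorphic images of \<open>H2\<close> are excluded, so that applications only have to
  check edges.\<close>

locale dense_locally_bipartite_no_H2 = dense_locally_bipartite +
  assumes no_H2:
    "\<lbrakk>adj a0 a1; adj a1 a2; adj a2 a3; adj a3 a4; adj a4 a5; adj a5 a6; adj a6 a0;
      adj a1 a3; adj a3 a5; adj a5 a0; adj a0 a2; adj a2 a4; adj a4 a6\<rbrakk> \<Longrightarrow> False"
begin

text \<open>This is \<open>H0\<close> plus an edge: \<open>b1, b0, b2, b3, b4, b5, b6\<close> play
  the roles of \<open>a0, ..., a6\<close>, and the edge from \<open>b0\<close> to \<open>b4\<close>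
  is the extra one.\<close>

lemma no_F1:
  assumes "adj b0 b1" "adj b0 b2" "adj b0 b3" "adj b0 b4" "adj b1 b5" "adj b1 b6"
    and "adj b1 b2" "adj b4 b5" "adj b4 b6" "adj b4 b3" "adj b2 b3" "adj b5 b6"
  shows False
proof -
  note e = assms assms[THEN adj_sym]
  \<comment> \<open>The weights total 15, so the neighbours of \<open>v\<close> weigh at least
    9.\<close>
  obtain v where "8 * 15 < 15 * ((if adj v b0 then 3 :: nat else 0) + (if adj v b1 then 3 else 0) + (if adj v b2 then 1 else 0)
      + (if adj v b3 then 1 else 0) + (if adj v b4 then 3 else 0) + (if adj v b5 then 2 else 0) + (if adj v b6 then 2 else 0))"
    using heavy_vertex[of "[(3, b0), (3, b1), (1, b2), (1, b3), (3, b4), (2, b5), (2, b6)]"]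
      e[THEN adj_in_V] by (auto simp: add.assoc simp del: One_nat_def)
  moreover have "\<not> (adj v b0 \<and> adj v b1 \<and> adj v b2)"
    using no_K4[of b0 b1 b2 v] adj_sym[of v] by (auto simp: e)
  moreover have "\<not> (adj v b0 \<and> adj v b2 \<and> adj v b3)"
    using no_K4[of b0 b2 b3 v] adj_sym[of v] by (auto simp: e)
  moreover have "\<not> (adj v b0 \<and> adj v b1 \<and> adj v b4)"
    using no_W5[of b0 b1 b2 b3 b4 v] adj_sym[of v] by (auto simp: e)
  moreover have "\<not> (adj v b0 \<and> adj v b3 \<and> adj v b4)"
    using no_K4[of b0 b3 b4 v] adj_sym[of v] by (auto simp: e)
  moreover have "\<not> (adj v b1 \<and> adj v b5 \<and> adj v b6)"
    using no_K4[of b1 b5 b6 v] adj_sym[of v] by (auto simp: e)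
  moreover have "\<not> (adj v b4 \<and> adj v b5 \<and> adj v b6)"
    using no_K4[of b4 b5 b6 v] adj_sym[of v] by (auto simp: e)
  \<comment> \<open>Up to swapping \<open>b5, b6\<close> and reflecting
    \<open>b1, b2, b3, b4\<close>, the last eight exclusions are only two. In each, \<open>v\<close>
    replaces one vertex and yields \<open>H2\<close>.\<close>
  moreover have "\<not> (adj v b0 \<and> adj v b1 \<and> adj v b3 \<and> adj v b5)"
    using no_H2[of b4 b3 b0 v b1 b5 b6] adj_sym[of v] by (auto simp: e)
  moreover have "\<not> (adj v b0 \<and> adj v b2 \<and> adj v b4 \<and> adj v b5)"
    using no_H2[of b1 b2 b0 v b4 b5 b6] adj_sym[of v] by (auto simp: e)
  moreover have "\<not> (adj v b1 \<and> adj v b2 \<and> adj v b4 \<and> adj v b5)"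
    using no_H2[of b4 b3 b0 b2 b1 v b5] adj_sym[of v] by (auto simp: e)
  moreover have "\<not> (adj v b1 \<and> adj v b3 \<and> adj v b4 \<and> adj v b5)"
    using no_H2[of b1 b2 b0 b3 b4 v b5] adj_sym[of v] by (auto simp: e)
  moreover have "\<not> (adj v b0 \<and> adj v b1 \<and> adj v b3 \<and> adj v b6)"
    using no_H2[of b4 b3 b0 v b1 b6 b5] adj_sym[of v] by (auto simp: e)
  moreover have "\<not> (adj v b0 \<and> adj v b2 \<and> adj v b4 \<and> adj v b6)"
    using no_H2[of b1 b2 b0 v b4 b6 b5] adj_sym[of v] by (auto simp: e)
  moreover have "\<not> (adj v b1 \<and> adj v b2 \<and> adj v b4 \<and> adj v b6)"
    using no_H2[of b4 b3 b0 b2 b1 v b6] adj_sym[of v] by (auto simp: e)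
  moreover have "\<not> (adj v b1 \<and> adj v b3 \<and> adj v b4 \<and> adj v b6)"
    using no_H2[of b1 b2 b0 b3 b4 v b6] adj_sym[of v] by (auto simp: e)
  \<comment> \<open>A set of neighbours avoiding all these patterns weighs at most 8.\<close>
  ultimately show False
    by (cases "adj v b0"; cases "adj v b1"; cases "adj v b2"; cases "adj v b3";
        cases "adj v b4"; cases "adj v b5"; cases "adj v b6"; simp)
qed

text \<open>Again \<open>H0\<close> plus an edge: \<open>c3, c4, c5, c0, c1, c6, c2\<close> play the
  roles of \<open>a0, ..., a6\<close>, and the edge from \<open>c4\<close> to \<open>c6\<close> is
  the extra one. As 8/15 exceeds 1/2, some vertex is adjacent to three vertices of the 4-cycle
  \<open>c0, c1, c6, c4\<close>.\<close>

lemma no_F2: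
  assumes "adj c0 c1" "adj c1 c2" "adj c2 c3" "adj c3 c4" "adj c4 c5" "adj c1 c6"
    and "adj c0 c4" "adj c0 c5" "adj c2 c6" "adj c3 c5" "adj c3 c6" "adj c4 c6"
  shows False
proof -
  note e = assms assms[THEN adj_sym]
  obtain v where "8 * 4 < 15 * ((if adj v c0 then 1 :: nat else 0) + (if adj v c1 then 1 else 0)
      + (if adj v c4 then 1 else 0) + (if adj v c6 then 1 else 0))"
    using heavy_vertex[of "[(1, c0), (1, c1), (1, c4), (1, c6)]"]
      e[THEN adj_in_V] by (auto simp: add.assoc simp del: One_nat_def)
  \<comment> \<open>If the middle one of the three is \<open>c0\<close> or \<open>c1\<close>, its
    edge to \<open>v\<close> completes the first excluded graph with the fan at \<open>c6\<close> or
    \<open>c4\<close>. If it is \<open>c4\<close> or \<open>c6\<close>, then \<open>v\<close> closes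
    the fan there to a 5-wheel.\<close>
  moreover have "\<not> (adj v c0 \<and> adj v c1 \<and> adj v c4)"
    using no_F1[of c6 c1 c2 c3 c4 c0 v] adj_sym[of v] by (auto simp: e)
  moreover have "\<not> (adj v c0 \<and> adj v c1 \<and> adj v c6)"
    using no_F1[of c4 c0 c5 c3 c6 c1 v] adj_sym[of v] by (auto simp: e)
  moreover have "\<not> (adj v c0 \<and> adj v c4 \<and> adj v c6)"
    using no_W5[of c4 c0 c5 c3 c6 v] adj_sym[of v] by (auto simp: e)
  moreover have "\<not> (adj v c1 \<and> adj v c4 \<and> adj v c6)"
    using no_W5[of c6 c1 c2 c3 c4 v] adj_sym[of v] by (auto simp: e)
  ultimately show False
    by (cases "adj v c0"; cases "adj v c1"; cases "adj v c4"; cases "adj v c6"; simp)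
qed

text \<open>\<open>H0\<close> is the Moser spindle: two diamonds sharing the tip \<open>a0\<close>,
  with their other tips \<open>a3\<close> and \<open>a4\<close> joined. Those two tips get the
  largest weights.\<close>

lemma no_H0:
  assumes "adj a0 a1" "adj a1 a2" "adj a2 a3" "adj a3 a4" "adj a4 a5" "adj a5 a6"
    and "adj a6 a0" "adj a0 a2" "adj a0 a5" "adj a1 a3" "adj a4 a6"
  shows False
proof -
  note e = assms assms[THEN adj_sym]
  obtain v where "8 * 15 < 15 * ((if adj v a0 then 1 :: nat else 0) + (if adj v a1 then 2 else 0) + (if adj v a2 then 2 else 0)
      + (if adj v a3 then 3 else 0) + (if adj v a4 then 3 else 0) + (if adj v a5 then 2 else 0) + (if adj v a6 then 2 else 0))"
    using heavy_vertex[of "[(1, a0), (2, a1), (2, a2), (3, a3), (3, a4), (2, a5), (2, a6)]"]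
      e[THEN adj_in_V] by (auto simp: add.assoc simp del: One_nat_def)
  moreover have "\<not> (adj v a0 \<and> adj v a1 \<and> adj v a2)"
    using no_K4[of a0 a1 a2 v] adj_sym[of v] by (auto simp: e)
  moreover have "\<not> (adj v a1 \<and> adj v a2 \<and> adj v a3)"
    using no_K4[of a1 a2 a3 v] adj_sym[of v] by (auto simp: e)
  moreover have "\<not> (adj v a4 \<and> adj v a5 \<and> adj v a6)"
    using no_K4[of a4 a5 a6 v] adj_sym[of v] by (auto simp: e)
  \<comment> \<open>From here on, \<open>v\<close> and six of the seven vertices form one of the two
    graphs excluded before.\<close>
  moreover have "\<not> (adj v a0 \<and> adj v a1 \<and> adj v a3 \<and> adj v a4)"
    using no_F1[of v a0 a1 a3 a4 a5 a6] adj_sym[of v] by (auto simp: e)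
  moreover have "\<not> (adj v a0 \<and> adj v a2 \<and> adj v a3 \<and> adj v a4)"
    using no_F1[of v a0 a2 a3 a4 a5 a6] adj_sym[of v] by (auto simp: e)
  moreover have "\<not> (adj v a1 \<and> adj v a2 \<and> adj v a4 \<and> adj v a5)"
    using no_F1[of a5 a0 a6 a4 v a1 a2] adj_sym[of v] by (auto simp: e)
  moreover have "\<not> (adj v a0 \<and> adj v a3 \<and> adj v a4 \<and> adj v a5)"
    using no_F1[of v a0 a5 a4 a3 a1 a2] adj_sym[of v] by (auto simp: e)
  moreover have "\<not> (adj v a1 \<and> adj v a3 \<and> adj v a4 \<and> adj v a5)"
    using no_F2[of a0 a5 a4 a3 a1 a2 v] adj_sym[of v] by (auto simp: e)
  moreover have "\<not> (adj v a2 \<and> adj v a3 \<and> adj v a4 \<and> adj v a5)"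
    using no_F2[of a0 a5 a4 a3 a2 a1 v] adj_sym[of v] by (auto simp: e)
  moreover have "\<not> (adj v a1 \<and> adj v a2 \<and> adj v a4 \<and> adj v a6)"
    using no_F1[of a6 a0 a5 a4 v a1 a2] adj_sym[of v] by (auto simp: e)
  moreover have "\<not> (adj v a0 \<and> adj v a3 \<and> adj v a4 \<and> adj v a6)"
    using no_F1[of v a0 a6 a4 a3 a1 a2] adj_sym[of v] by (auto simp: e)
  moreover have "\<not> (adj v a1 \<and> adj v a3 \<and> adj v a4 \<and> adj v a6)"
    using no_F2[of a0 a6 a4 a3 a1 a2 v] adj_sym[of v] by (auto simp: e)
  moreover have "\<not> (adj v a2 \<and> adj v a3 \<and> adj v a4 \<and> adj v a6)"
    using no_F2[of a0 a6 a4 a3 a2 a1 v] adj_sym[of v] by (auto simp: e)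
  moreover have "\<not> (adj v a1 \<and> adj v a3 \<and> adj v a5 \<and> adj v a6)"
    using no_F1[of a1 a0 a2 a3 v a5 a6] adj_sym[of v] by (auto simp: e)
  moreover have "\<not> (adj v a2 \<and> adj v a3 \<and> adj v a5 \<and> adj v a6)"
    using no_F1[of a2 a0 a1 a3 v a5 a6] adj_sym[of v] by (auto simp: e)
  ultimately show False
    by (cases "adj v a0"; cases "adj v a1"; cases "adj v a2"; cases "adj v a3";
        cases "adj v a4"; cases "adj v a5"; cases "adj v a6"; simp)
qed

end

lemma C7_edges:
  "{{i, (i + 1) mod 7} | i :: nat. i < 7} = {{0, 1}, {1, 2}, {2, 3}, {3, 4}, {4, 5}, {5, 6}, {6, 0}}"
proof -
  have "{..<7 :: nat} = {0, 1, 2, 3, 4, 5, 6}"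
    by auto
  moreover have "{{i, (i + 1) mod 7} | i :: nat. i < 7} = (\<lambda>i. {i, (i + 1) mod 7}) ` {..<7}"
    by auto
  ultimately show ?thesis by (simp del: One_nat_def)
qed

theorem theorem3p3:
  fixes G :: "'a graph"
  assumes "simple_graph G"
    and "locally_bipartite G"
    and "contains_subgraph G H0"
    and "real (min_degree G) > 8 / 15 * real (card (verts G))"
  shows "contains_subgraph G H2"
proof (rule ccontr)
  assume no: "\<not> contains_subgraph G H2"
  define adj where "adj u v \<longleftrightarrow> {u, v} \<in> edges G" for u v
  have fin: "finite (verts G)" and edge: "\<And>e. e \<in> edges G \<Longrightarrow> e \<subseteq> verts G \<and> card e = 2"
    using assms(1) by (auto simp: simple_graph_def)
  obtain f where f: "\<And>e. e \<in> edges H0 \<Longrightarrow> f ` e \<in> edges G"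
    using assms(3) by (auto simp: contains_subgraph_def subgraph_def image_graph_def image_subset_iff)
  interpret dense_locally_bipartite "verts G" adj
  proof
    show "finite (verts G)" by (fact fin)
    show "u \<in> verts G" if "adj u v" for u v using that edge by (auto simp: adj_def)
    show "adj v u" if "adj u v" for u v using that by (simp add: adj_def insert_commute)
    show "\<not> adj v v" for v using edge[of "{v, v}"] by (auto simp: adj_def)
    show "\<exists>side :: 'a \<Rightarrow> bool. \<forall>u v. adj c u \<longrightarrow> adj c v \<longrightarrow> adj u v \<longrightarrow> side u \<noteq> side v"
      if c: "c \<in> verts G" for c
    proof -
      let ?N = "neighbourhood G c"
      obtain A B where AB: "A \<union> B = ?N"
        "\<And>e. e \<in> edges G \<Longrightarrow> e \<subseteq> ?N \<Longrightarrow> \<not> e \<subseteq> A \<and> \<not> e \<subseteq> B"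
        using assms(2) c
        unfolding locally_bipartite_def bipartite_def induced_subgraph_def by fastforce
      \<comment> \<open>Neighbours of \<open>c\<close> outside \<open>A\<close> lie in
        \<open>B\<close>, so membership in \<open>A\<close> serves as the colouring.\<close>
      have "(u \<in> A) \<noteq> (v \<in> A)" if "adj c u" "adj c v" "adj u v" for u v
      proof -
        have "u \<in> ?N" "v \<in> ?N"
          using that edge by (auto simp: neighbourhood_def adj_def insert_commute)
        then show ?thesis using AB(1) AB(2)[of "{u, v}"] that(3) by (auto simp: adj_def)
      qed
      then show ?thesis by (intro exI[of _ "\<lambda>u. u \<in> A"]) simp
    qed
    show "8 * card (verts G) < 15 * card {u \<in> verts G. adj u v}" if "v \<in> verts G" for v
    proof -
      have "min_degree G \<le> degree G v"
        using fin that by (simp add: min_degree_def)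
      then have "8 * real (card (verts G)) < 15 * real (degree G v)"
        using assms(4) by simp
      then show ?thesis
        by (simp add: degree_def neighbourhood_def adj_def)
    qed
  qed
  interpret dense_locally_bipartite_no_H2 "verts G" adj
  proof
    fix a0 a1 a2 a3 a4 a5 a6
    assume e: "adj a0 a1" "adj a1 a2" "adj a2 a3" "adj a3 a4" "adj a4 a5" "adj a5 a6" "adj a6 a0"
      "adj a1 a3" "adj a3 a5" "adj a5 a0" "adj a0 a2" "adj a2 a4" "adj a4 a6"
    let ?xs = "[a0, a1, a2, a3, a4, a5, a6]"
    let ?f = "(!) ?xs"
    have "inj_on ?f (verts H2)"
      using H2_hom_distinct[OF e] by (simp add: H2_def inj_on_nth)
    moreover have "?f ` verts H2 \<subseteq> verts G"
    proof (rule subset_trans)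
      show "?f ` verts H2 \<subseteq> set ?xs"
        by (intro image_subsetI nth_mem) (simp add: H2_def)
      show "set ?xs \<subseteq> verts G"
        using e[THEN adj_in_V] by simp
    qed
    moreover have "?f ` x \<in> edges G" if "x \<in> edges H2" for x
      using that e unfolding H2_def C7_edges adj_def by auto
    ultimately have "contains_subgraph G H2"
      unfolding contains_subgraph_def
      by (intro exI[of _ ?f]) (simp add: subgraph_def image_graph_def image_subset_iff)
    with no show False ..
  qed
  have "adj (f i) (f j)" if "{i, j} \<in> edges H0" for i j
    using f[OF that] by (simp add: adj_def)
  then show False
    by (intro no_H0[of "f 0" "f 1" "f 2" "f 3" "f 4" "f 5" "f 6"])
      (simp_all add: H0_def C7_edges del: One_nat_def)
qed

end
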